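(* Let $H_0,\dots,H_m\in\mathbb{R}^{n\times n}$ be symmetric matrices and let $G(\delta)=H_0+\sum_{i=1}^m\delta_iH_i$ for $\delta\in\mathbb{R}^m$. Then $G(\delta)\ge 0$ for all $\delta$ in the unit cube $\{\delta\in\mathbb{R}^m\mid |\delta_i|\le 1\text{ for all } i\}$ if and only if there exist $S_0\in\Sigma[\delta]^n$ and $S_1,\dots,S_m\in\mathcal{Q}_1$ such that, identically in $\delta$, $$G(\delta)=S_0(\delta)+\sum_{i=1}^m(1-\delta_i^2)S_i(\delta).$$
   Context: $\Sigma[\delta]^n$ is the set of symmetric $n\times n$ matrices $S$ with entries in $\mathbb{R}[\delta_1,\dots,\delta_m]$ that are sum-of-squares, i.e. for which there exist $q$ and $T\in\mathbb{R}[\delta]^{n\times q}$ with $S(\delta)=T(\delta)T(\delta)^T$. $\mathcal{Q}_1$ is the set of symmetric $n\times n$ polynomial matrices of degree at most $2$ in each variable: $\mathcal{Q}_1=\{\sum_{\alpha\in W_1}C_\alpha\delta^\alpha\mid C_\alpha\in\mathbb{R}^{n\times n}\text{ symmetric for all }\alpha\in W_1\}$, where $W_1=\{\alpha\in\mathbb{N}^m\mid\alpha_i\le 2\text{ for all } i=1,\dots,m\}$ and $\delta^\alpha=\delta_1^{\alpha_1}\cdots\delta_m^{\alpha_m}$ (so its elements have total degree at most $2m$). For a symmetric matrix $X$, $X\ge 0$ means positive semidefinite. *)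

theory Defs
  imports "HOL-Analysis.Analysis"
begin

(* Polynomials in \<real>[\<delta>_1, ..., \<delta>_m] are represented by the polynomial functions they induce on real^'m;
   as the field is infinite, this identifies the polynomial ring with the ring of polynomial
   functions, and an identity of polynomials is an identity at every point. *)

definition sym_mat :: "real^'n^'n \<Rightarrow> bool" where
  "sym_mat A \<longleftrightarrow> transpose A = A"

definition psd_mat :: "real^'n^'n \<Rightarrow> bool" where
  "psd_mat A \<longleftrightarrow> sym_mat A \<and> (\<forall>x. 0 \<le> x \<bullet> (A *v x))"

(* The entry equation says S = T T^t for the matrix T with n rows and q columns whose (i, k) entry
   is T i k. The number q of columns is existentially quantified, so it cannot be a type index. *)
definition sos_matrices :: "(real^'m \<Rightarrow> real^'n^'n) set" where
  "sos_matrices = {S.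
     (\<forall>d. sym_mat (S d)) \<and>
     (\<forall>i j. real_polynomial_function (\<lambda>d. S d $ i $ j)) \<and>
     (\<exists>(q::nat) (T :: 'n \<Rightarrow> nat \<Rightarrow> real^'m \<Rightarrow> real).
        (\<forall>i. \<forall>k<q. real_polynomial_function (T i k)) \<and>
        (\<forall>d i j. S d $ i $ j = (\<Sum>k<q. T i k d * T j k d)))}"

definition monomial_fun :: "('m \<Rightarrow> nat) \<Rightarrow> real^'m \<Rightarrow> real" where
  "monomial_fun \<alpha> d = (\<Prod>i\<in>UNIV. (d $ i) ^ \<alpha> i)"

definition W1 :: "('m::finite \<Rightarrow> nat) set" where
  "W1 = {\<alpha>. \<forall>i. \<alpha> i \<le> 2}"

(* This rules out the convention that a sum over an infinite set is zero. *)
lemma finite_W1: "finite (W1 :: ('m::finite \<Rightarrow> nat) set)"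
proof -
  have "finite (Pi\<^sub>E (UNIV :: 'm set) (\<lambda>_. {..2::nat}))"
    by (intro finite_PiE) auto
  moreover have "(W1 :: ('m \<Rightarrow> nat) set) = Pi\<^sub>E UNIV (\<lambda>_. {..2})"
    by (auto simp: W1_def PiE_UNIV_domain)
  ultimately show ?thesis
    by (simp only:)
qed

definition Q1 :: "(real^'m \<Rightarrow> real^'n^'n) set" where
  "Q1 = {S. \<exists>C :: ('m \<Rightarrow> nat) \<Rightarrow> real^'n^'n.
     (\<forall>\<alpha>\<in>W1. sym_mat (C \<alpha>)) \<and>
     (\<forall>d. S d = (\<Sum>\<alpha>\<in>W1. monomial_fun \<alpha> d *\<^sub>R C \<alpha>))}"

definition unit_cube :: "(real^'m) set" where
  "unit_cube = {d. \<forall>i. \<bar>d $ i\<bar> \<le> 1}"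

end

theory Submission
  imports Defs
begin

text \<open>On the vertices of the cube all terms \<open>1 - \<delta>\<^sub>i\<^sup>2\<close> vanish, so a certificate makes \<open>G\<close> positive
  semidefinite there; \<open>G\<close> is a convex combination of its vertex values, with weights the Lagrange
  functions \<open>e\<^sub>v = (\<Prod>i. f\<^sub>i)\<close>, \<open>f\<^sub>i = (1 + v\<^sub>i \<delta>\<^sub>i) / 2\<close>. Conversely, \<open>f\<^sub>i - f\<^sub>i\<^sup>2 = (1 - \<delta>\<^sub>i\<^sup>2) / 4\<close>, so
  telescoping writes \<open>e\<^sub>v - e\<^sub>v\<^sup>2\<close> as \<open>\<Sum>i. (1 - \<delta>\<^sub>i\<^sup>2) s\<^sub>i\<close> with \<open>s\<^sub>i\<close> of degree at most 2 in each variable,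
  and \<open>G = (\<Sum>v. e\<^sub>v G(v))\<close> differs by such terms from the sum of squares \<open>\<Sum>v. e\<^sub>v\<^sup>2 G(v)\<close>.\<close>

section \<open>Positive semidefinite matrices and their Gram factorization\<close>

lemma inner_matrix_vector_mult_sum:
  fixes A :: "real^'n^'m"
  shows "x \<bullet> (A *v y) = (\<Sum>i\<in>UNIV. \<Sum>j\<in>UNIV. x $ i * A $ i $ j * y $ j)"
  by (simp add: inner_vec_def matrix_vector_mult_def sum_distrib_left mult.assoc)

lemma sym_mat_iff: "sym_mat A \<longleftrightarrow> (\<forall>i j. A $ i $ j = A $ j $ i)"
  by (auto simp: sym_mat_def transpose_def vec_eq_iff)

lemma psd_matD: "psd_mat A \<Longrightarrow> 0 \<le> x \<bullet> (A *v x)"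
  by (simp add: psd_mat_def)

lemma psd_mat_sum_scaleR:
  fixes A :: "'a \<Rightarrow> real^'n^'n"
  assumes "\<And>v. v \<in> V \<Longrightarrow> 0 \<le> c v" and "\<And>v. v \<in> V \<Longrightarrow> psd_mat (A v)"
  shows "psd_mat (\<Sum>v\<in>V. c v *\<^sub>R A v)"
  using assms
proof (induction V rule: infinite_finite_induct)
  case (insert v V)
  have "psd_mat (c v *\<^sub>R A v)"
    using insert.prems[of v] by (simp add: psd_mat_def sym_mat_iff scaleR_matrix_vector_assoc[symmetric])
  moreover have "psd_mat (\<Sum>v\<in>V. c v *\<^sub>R A v)"
    using insert by simp
  ultimately show ?case
    using insert.hyps by (simp add: psd_mat_def sym_mat_iff matrix_vector_mult_add_rdistrib inner_add_right)
qed (simp_all add: psd_mat_def sym_mat_iff)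

lemma inner_axis_matrix_vector_mult_axis:
  fixes A :: "real^'n^'m"
  shows "axis i 1 \<bullet> (A *v axis j 1) = A $ i $ j"
  by (simp add: inner_axis' matrix_vector_mult_basis column_def)

text \<open>This is the form of \<open>A\<close> at \<open>x - t *\<^sub>R axis i 1\<close>. The
  free \<open>t\<close> serves twice: large values kill a row with zero diagonal entry, and the
  minimizing value yields positivity of the Schur complement.\<close>

lemma psd_mat_quadratic:
  fixes A :: "real^'n^'n"
  assumes "psd_mat A"
  shows "0 \<le> x \<bullet> (A *v x) - 2 * t * (column i A \<bullet> x) + t\<^sup>2 * A $ i $ i"
proof -
  have sym: "transpose A = A"
    using assms by (simp add: psd_mat_def sym_mat_def)
  have 1: "axis i 1 \<bullet> (A *v x) = column i A \<bullet> x"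
    by (metis sym dot_lmul_matrix matrix_vector_mult_basis transpose_matrix_vector)
  have 2: "x \<bullet> (A *v axis i 1) = column i A \<bullet> x"
    by (simp add: matrix_vector_mult_basis inner_commute)
  have "0 \<le> (x - t *\<^sub>R axis i 1) \<bullet> (A *v (x - t *\<^sub>R axis i 1))"
    by (rule psd_matD[OF assms])
  also have "\<dots> = x \<bullet> (A *v x) - 2 * t * (column i A \<bullet> x) + t\<^sup>2 * A $ i $ i"
    by (simp add: matrix_vector_mult_diff_distrib matrix_vector_mult_scaleR inner_diff_left inner_diff_right
        1 2 inner_axis_matrix_vector_mult_axis power2_eq_square algebra_simps)
  finally show ?thesis .
qed

lemma psd_mat_diag_nonneg: "psd_mat A \<Longrightarrow> 0 \<le> A $ i $ i"
  by (metis inner_axis_matrix_vector_mult_axis psd_matD)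

lemma psd_mat_diag_zero:
  fixes A :: "real^'n^'n"
  assumes "psd_mat A" and "A $ i $ i = 0"
  shows "A $ i $ j = 0" and "A $ j $ i = 0"
proof -
  have eq: "A $ i $ j = A $ j $ i"
    using assms(1) by (simp add: psd_mat_def sym_mat_iff)
  have "0 \<le> A $ j $ j - 2 * t * A $ j $ i" for t
    using psd_mat_quadratic[OF assms(1), of "axis j 1" t i] assms(2)
    by (simp add: inner_axis_matrix_vector_mult_axis inner_axis column_def)
  \<comment> \<open>If \<open>A $ j $ i\<close> were nonzero, this \<open>t\<close> would make the
    bound, which is affine in \<open>t\<close>, read \<open>0 \<le> -1\<close>.\<close>
  from this[of "(A $ j $ j + 1) / (2 * A $ j $ i)"] show "A $ j $ i = 0"
    by (cases "A $ j $ i = 0") auto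
  with eq show "A $ i $ j = 0" by simp
qed

text \<open>Symmetric Gaussian elimination, as in the Cholesky factorization: each step splits off a
  rank-one term at a pivot and continues with the Schur complement. The matrix keeps its size; it is
  the set \<open>J\<close> of indices with a possibly nonzero diagonal entry that shrinks.\<close>

lemma psd_mat_gram_aux:
  fixes A :: "real^'n^'n"
  assumes "finite J" and "psd_mat A" and "\<And>i. i \<notin> J \<Longrightarrow> A $ i $ i = 0"
  shows "\<exists>u :: 'n \<Rightarrow> 'n \<Rightarrow> real. \<forall>i j. A $ i $ j = (\<Sum>k\<in>J. u k i * u k j)"
  using assms
proof (induction J arbitrary: A rule: finite_induct)
  case empty
  then have "A $ i $ j = 0" for i j
    by (simp add: psd_mat_diag_zero(1)[of A i])
  then show ?case by simp
next
  case (insert p J)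
  show ?case
  proof (cases "A $ p $ p = 0")
    case True
    then obtain u where u: "\<forall>i j. A $ i $ j = (\<Sum>k\<in>J. u k i * u k j)"
      using insert.IH[of A] insert.prems by (metis insertE)
    \<comment> \<open>A zero pivot calls for no elimination; index \<open>p\<close> contributes the
      zero vector.\<close>
    have "A $ i $ j = (\<Sum>k\<in>insert p J. (u(p := \<lambda>_. 0)) k i * (u(p := \<lambda>_. 0)) k j)" for i j
      using u insert.hyps by (auto intro!: sum.cong)
    then show ?thesis by blast
  next
    case False
    define a where "a = A $ p $ p"
    have a: "a > 0"
      using False psd_mat_diag_nonneg[OF insert.prems(1), of p] by (simp add: a_def)
    have sym: "A $ i $ j = A $ j $ i" for i j
      using insert.prems(1) by (simp add: psd_mat_def sym_mat_iff)
    \<comment> \<open>the Schur complement of the pivot \<open>a\<close>\<close>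
    define B where "B = (\<chi> i j. A $ i $ j - A $ i $ p * A $ j $ p / a)"
    have quad: "x \<bullet> (B *v x) = x \<bullet> (A *v x) - (column p A \<bullet> x)\<^sup>2 / a" for x
    proof -
      have "(column p A \<bullet> x)\<^sup>2 / a
          = (\<Sum>i\<in>UNIV. \<Sum>j\<in>UNIV. x $ i * (A $ i $ p * A $ j $ p / a) * x $ j)"
        by (simp add: inner_vec_def column_def power2_eq_square sum_product sum_divide_distrib mult_ac)
      then show ?thesis
        by (simp add: inner_matrix_vector_mult_sum B_def right_diff_distrib left_diff_distrib sum_subtractf)
    qed
    have "0 \<le> x \<bullet> (B *v x)" for x
    proof -
      \<comment> \<open>The value \<open>t = (column p A \<bullet> x) / a\<close> minimizes the
        quadratic in \<open>t\<close>, and the minimum is the form of \<open>B\<close> at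
        \<open>x\<close>.\<close>
      have "0 \<le> x \<bullet> (A *v x) - 2 * ((column p A \<bullet> x) / a) * (column p A \<bullet> x)
          + ((column p A \<bullet> x) / a)\<^sup>2 * a"
        unfolding a_def by (rule psd_mat_quadratic[OF insert.prems(1)])
      also have "\<dots> = x \<bullet> (B *v x)"
        using a by (simp add: quad power2_eq_square field_simps)
      finally show ?thesis .
    qed
    then have "psd_mat B"
      by (auto simp: psd_mat_def sym_mat_iff B_def sym mult.commute)
    \<comment> \<open>At the pivot the entry is \<open>a - a * a / a = 0\<close>. For any other
      \<open>i\<close> outside \<open>J\<close>, row \<open>i\<close> of \<open>A\<close> already
      vanishes, so elimination leaves the diagonal entry at zero.\<close>
    moreover have "B $ i $ i = 0" if "i \<notin> J" for i
    proof (cases "i = p")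
      case True
      then show ?thesis using a by (simp add: B_def a_def)
    next
      case False
      then have "A $ i $ i = 0" using insert.prems(2) that by blast
      then show ?thesis
        using psd_mat_diag_zero(1)[OF insert.prems(1), of i p] by (simp add: B_def)
    qed
    ultimately obtain u where u: "\<forall>i j. B $ i $ j = (\<Sum>k\<in>J. u k i * u k j)"
      using insert.IH by blast
    \<comment> \<open>The new vector is the pivot column over \<open>sqrt a\<close>; its outer
      square is the rank-one term removed from \<open>A\<close>. Since \<open>p\<close> is not in
      \<open>J\<close>, the other vectors are unchanged.\<close>
    define w where "w = u(p := \<lambda>i. A $ i $ p / sqrt a)"
    have "A $ i $ j = (\<Sum>k\<in>insert p J. w k i * w k j)" for i j
    proof -
      have "A $ i $ j = A $ i $ p * A $ j $ p / a + B $ i $ j"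
        by (simp add: B_def)
      also have "\<dots> = w p i * w p j + (\<Sum>k\<in>J. u k i * u k j)"
        using a u by (simp add: w_def)
      also have "(\<Sum>k\<in>J. u k i * u k j) = (\<Sum>k\<in>J. w k i * w k j)"
        using insert.hyps by (intro sum.cong) (auto simp: w_def)
      finally show ?thesis
        using insert.hyps by simp
    qed
    then show ?thesis by blast
  qed
qed

lemma psd_mat_gram:
  fixes A :: "real^'n^'n"
  assumes "psd_mat A"
  obtains u :: "'n \<Rightarrow> 'n \<Rightarrow> real" where "\<And>i j. A $ i $ j = (\<Sum>k\<in>UNIV. u k i * u k j)"
  using psd_mat_gram_aux[OF finite[of UNIV] assms] by auto

section \<open>Sum-of-squares matrices\<close>

lemma sos_matricesI:
  fixes S :: "real^'m \<Rightarrow> real^'n^'n" and T :: "'n \<Rightarrow> 'k \<Rightarrow> real^'m \<Rightarrow> real"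
  assumes "finite K"
    and poly: "\<And>i k. k \<in> K \<Longrightarrow> real_polynomial_function (T i k)"
    and S: "\<And>d i j. S d $ i $ j = (\<Sum>k\<in>K. T i k d * T j k d)"
  shows "S \<in> sos_matrices"
proof -
  \<comment> \<open>Renaming the columns by an initial segment of the naturals lets later
    factorizations use any finite index set, in particular pairs.\<close>
  obtain h where h: "bij_betw h {..<card K} K"
    using ex_bij_betw_nat_finite[OF \<open>finite K\<close>] by (auto simp: atLeast0LessThan)
  have "S d $ i $ j = (\<Sum>k<card K. T i (h k) d * T j (h k) d)" for d i j
    unfolding S by (rule sum.reindex_bij_betw[OF h, symmetric])
  moreover have "real_polynomial_function (T i (h k))" if "k < card K" for i k
    using poly h that by (auto simp: bij_betw_def)
  ultimately have "\<exists>(q::nat) (T :: 'n \<Rightarrow> nat \<Rightarrow> real^'m \<Rightarrow> real).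
        (\<forall>i. \<forall>k<q. real_polynomial_function (T i k)) \<and>
        (\<forall>d i j. S d $ i $ j = (\<Sum>k<q. T i k d * T j k d))"
    by (intro exI[of _ "card K"] exI[of _ "\<lambda>i k. T i (h k)"]) blast
  moreover have "sym_mat (S d)" for d
    by (simp add: sym_mat_iff S mult.commute)
  moreover have "real_polynomial_function (\<lambda>d. S d $ i $ j)" for i j
    unfolding S using \<open>finite K\<close> poly
    by (intro real_polynomial_function_sum real_polynomial_function.intros(4)) auto
  ultimately show ?thesis
    by (simp add: sos_matrices_def)
qed

text \<open>With \<open>S = T T^t\<close>, the form at \<open>x\<close> is the squared norm of
  \<open>T^t x\<close>, a sum of one square per column.\<close>

lemma sos_matrices_psd:
  assumes "S \<in> sos_matrices"
  shows "psd_mat (S d)"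
proof -
  obtain q T where S: "\<And>i j. S d $ i $ j = (\<Sum>k<(q::nat). T i k d * T j k d)"
    using assms unfolding sos_matrices_def by blast
  have "x \<bullet> (S d *v x) = (\<Sum>k<q. (\<Sum>i\<in>UNIV. x $ i * T i k d)\<^sup>2)" for x
  proof -
    have "x \<bullet> (S d *v x) = (\<Sum>i\<in>UNIV. \<Sum>j\<in>UNIV. \<Sum>k<q. (x $ i * T i k d) * (x $ j * T j k d))"
      by (simp add: inner_matrix_vector_mult_sum S sum_distrib_left sum_distrib_right algebra_simps)
    also have "\<dots> = (\<Sum>i\<in>UNIV. \<Sum>k<q. \<Sum>j\<in>UNIV. (x $ i * T i k d) * (x $ j * T j k d))"
      by (intro sum.cong refl sum.swap)
    also have "\<dots> = (\<Sum>k<q. \<Sum>i\<in>UNIV. \<Sum>j\<in>UNIV. (x $ i * T i k d) * (x $ j * T j k d))"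
      by (rule sum.swap)
    finally show ?thesis
      by (simp add: power2_eq_square sum_product)
  qed
  moreover have "sym_mat (S d)"
    using assms by (simp add: sos_matrices_def)
  ultimately show ?thesis
    by (simp add: psd_mat_def sum_nonneg)
qed

section \<open>Polynomial matrices of degree at most 2 in each variable\<close>

lemma W1_eq_PiE: "W1 = Pi\<^sub>E (UNIV :: 'm::finite set) (\<lambda>_. {..2})"
  by (auto simp: W1_def PiE_UNIV_domain)

lemma Q1_sum:
  fixes S :: "'a \<Rightarrow> real^'m \<Rightarrow> real^'n^'n"
  assumes "\<And>v. v \<in> V \<Longrightarrow> S v \<in> Q1"
  shows "(\<lambda>d. \<Sum>v\<in>V. S v d) \<in> Q1"
proof -
  from assms obtain C where C: "\<And>v \<alpha>. v \<in> V \<Longrightarrow> \<alpha> \<in> W1 \<Longrightarrow> sym_mat (C v \<alpha> :: real^'n^'n)"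
    "\<And>v d. v \<in> V \<Longrightarrow> S v d = (\<Sum>\<alpha>\<in>W1. monomial_fun \<alpha> d *\<^sub>R C v \<alpha>)"
    unfolding Q1_def mem_Collect_eq by metis
  have "sym_mat (\<Sum>v\<in>V. C v \<alpha>)" if "\<alpha> \<in> W1" for \<alpha>
    using C(1) that by (auto simp: sym_mat_iff intro!: sum.cong)
  moreover have "(\<Sum>v\<in>V. S v d) = (\<Sum>\<alpha>\<in>W1. monomial_fun \<alpha> d *\<^sub>R (\<Sum>v\<in>V. C v \<alpha>))" for d
  proof -
    have "(\<Sum>v\<in>V. S v d) = (\<Sum>v\<in>V. \<Sum>\<alpha>\<in>W1. monomial_fun \<alpha> d *\<^sub>R C v \<alpha>)"
      using C(2) by (intro sum.cong) auto
    also have "\<dots> = (\<Sum>\<alpha>\<in>W1. \<Sum>v\<in>V. monomial_fun \<alpha> d *\<^sub>R C v \<alpha>)"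
      by (rule sum.swap)
    finally show ?thesis
      by (simp add: scaleR_sum_right)
  qed
  ultimately show ?thesis
    unfolding Q1_def mem_Collect_eq by (intro exI[of _ "\<lambda>\<alpha>. \<Sum>v\<in>V. C v \<alpha>"]) blast
qed

text \<open>Expanding the product picks one of three powers from each univariate factor. These
  choices are exactly the exponents in \<open>W1\<close>, and the coefficient of a choice \<alpha>
  is the product of the \<open>c i (\<alpha> i)\<close>.\<close>

lemma Q1_prod_scaleR:
  fixes A :: "real^'n^'n" and f :: "'m::finite \<Rightarrow> real \<Rightarrow> real"
  assumes "sym_mat A" and f: "\<And>i t. f i t = (\<Sum>k\<le>2. c i k * t ^ k)"
  shows "(\<lambda>d. (\<Prod>i\<in>UNIV. f i (d $ i)) *\<^sub>R A) \<in> Q1"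
proof -
  have "(\<Prod>i\<in>UNIV. f i (d $ i)) *\<^sub>R A
      = (\<Sum>\<alpha>\<in>W1. monomial_fun \<alpha> d *\<^sub>R ((\<Prod>i\<in>UNIV. c i (\<alpha> i)) *\<^sub>R A))" for d :: "real^'m"
  proof -
    have "(\<Prod>i\<in>UNIV. f i (d $ i)) = (\<Sum>\<alpha>\<in>W1. \<Prod>i\<in>UNIV. c i (\<alpha> i) * (d $ i) ^ \<alpha> i)"
      unfolding f W1_eq_PiE by (rule prod_sum_PiE) auto
    then show ?thesis
      by (simp add: monomial_fun_def prod.distrib scaleR_sum_left mult.commute)
  qed
  moreover have "sym_mat ((\<Prod>i\<in>UNIV. c i (\<alpha> i)) *\<^sub>R A)" for \<alpha>
    using assms(1) by (simp add: sym_mat_iff)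
  ultimately show ?thesis
    unfolding Q1_def mem_Collect_eq
    by (intro exI[of _ "\<lambda>\<alpha>. (\<Prod>i\<in>UNIV. c i (\<alpha> i)) *\<^sub>R A"]) blast
qed

text \<open>With \<open>X = prod x J\<close>, one has \<open>x p * X - (x p * X)^2 = (x p - (x p)^2)
  * X + (x p)^2 * (X - X^2)\<close>, which drives the induction. The exponents are chosen before
  \<open>x\<close>, so one \<beta> serves all vertices and all points; the bound 2 keeps the
  multipliers in \<open>Q1\<close> once each \<open>x j\<close> is affine in the \<open>j\<close>-th
  variable.\<close>

lemma prod_minus_prod_square:
  assumes "finite J"
  shows "\<exists>\<beta> :: 'i \<Rightarrow> 'i \<Rightarrow> nat. (\<forall>i j. \<beta> i j \<le> 2) \<and> (\<forall>x :: 'i \<Rightarrow> 'a::comm_ring_1.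
    prod x J - (prod x J)\<^sup>2 = (\<Sum>i\<in>J. (x i - (x i)\<^sup>2) * (\<Prod>j\<in>J. x j ^ \<beta> i j)))"
  using assms
proof (induction J rule: finite_induct)
  case empty
  show ?case by (intro exI[of _ "\<lambda>_ _. 0"]) simp
next
  case (insert p J)
  then obtain \<beta> where \<beta>: "\<And>i j. \<beta> i j \<le> (2::nat)"
    and eq: "\<And>x :: 'i \<Rightarrow> 'a.
      prod x J - (prod x J)\<^sup>2 = (\<Sum>i\<in>J. (x i - (x i)\<^sup>2) * (\<Prod>j\<in>J. x j ^ \<beta> i j))"
    by blast
  \<comment> \<open>Row \<open>p\<close> encodes the multiplier \<open>prod x J\<close>; every other
    row keeps its exponents from \<beta> and gains the factor \<open>(x p)^2\<close>.\<close>
  define \<gamma> where "\<gamma> i j = (if i = p then (if j = p then 0 else 1) else if j = p then 2 else \<beta> i j)" for i j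
  have "prod x (insert p J) - (prod x (insert p J))\<^sup>2
      = (\<Sum>i\<in>insert p J. (x i - (x i)\<^sup>2) * (\<Prod>j\<in>insert p J. x j ^ \<gamma> i j))" for x :: "'i \<Rightarrow> 'a"
  proof -
    have 1: "(\<Prod>j\<in>insert p J. x j ^ \<gamma> p j) = prod x J"
      using insert.hyps by (auto simp: \<gamma>_def intro!: prod.cong)
    have 2: "(\<Prod>j\<in>insert p J. x j ^ \<gamma> i j) = (x p)\<^sup>2 * (\<Prod>j\<in>J. x j ^ \<beta> i j)" if "i \<in> J" for i
    proof -
      have "(\<Prod>j\<in>J. x j ^ \<gamma> i j) = (\<Prod>j\<in>J. x j ^ \<beta> i j)"
        using insert.hyps that by (intro prod.cong) (auto simp: \<gamma>_def)
      moreover have "\<gamma> i p = 2"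
        using insert.hyps that by (auto simp: \<gamma>_def)
      ultimately show ?thesis
        using insert.hyps by simp
    qed
    have "(\<Sum>i\<in>insert p J. (x i - (x i)\<^sup>2) * (\<Prod>j\<in>insert p J. x j ^ \<gamma> i j))
        = (x p - (x p)\<^sup>2) * prod x J
          + (\<Sum>i\<in>J. (x i - (x i)\<^sup>2) * (\<Prod>j\<in>insert p J. x j ^ \<gamma> i j))"
      by (simp only: sum.insert[OF insert.hyps] 1)
    also have "(\<Sum>i\<in>J. (x i - (x i)\<^sup>2) * (\<Prod>j\<in>insert p J. x j ^ \<gamma> i j))
        = (x p)\<^sup>2 * (prod x J - (prod x J)\<^sup>2)"
      unfolding eq sum_distrib_left by (intro sum.cong) (simp_all only: 2 mult.left_commute)
    finally show ?thesis
      using insert.hyps by (simp add: algebra_simps power2_eq_square)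
  qed
  moreover have "\<gamma> i j \<le> 2" for i j
    using \<beta> by (simp add: \<gamma>_def)
  ultimately show ?case by blast
qed

section \<open>Lagrange interpolation at the vertices of the cube\<close>

definition vertex_weight :: "('m \<Rightarrow> real) \<Rightarrow> real^'m \<Rightarrow> real" where
  "vertex_weight v d = (\<Prod>i\<in>UNIV. (1 + v i * d $ i) / 2)"

text \<open>Vertices are functions rather than vectors, so that \<open>prod_sum_PiE\<close> turns
  sums over vertices into products of two-term sums.\<close>

abbreviation cube_vertices :: "('m \<Rightarrow> real) set" where
  "cube_vertices \<equiv> Pi\<^sub>E UNIV (\<lambda>_. {-1, 1})"

lemma finite_cube_vertices: "finite (cube_vertices :: ('m::finite \<Rightarrow> real) set)"
  by (intro finite_PiE) auto

lemma cube_vertices_cases: "v \<in> cube_vertices \<Longrightarrow> v i = -1 \<or> v i = 1"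
  by (auto simp: PiE_UNIV_domain)

lemma vertex_weight_nonneg:
  assumes "v \<in> cube_vertices" and "d \<in> unit_cube"
  shows "0 \<le> vertex_weight v d"
  unfolding vertex_weight_def
proof (intro prod_nonneg ballI)
  fix i
  have "\<bar>d $ i\<bar> \<le> 1"
    using assms(2) by (simp add: unit_cube_def)
  then show "0 \<le> (1 + v i * d $ i) / 2"
    using cube_vertices_cases[OF assms(1), of i] by auto
qed

lemma real_polynomial_function_vertex_weight:
  fixes v :: "'m::finite \<Rightarrow> real"
  shows "real_polynomial_function (vertex_weight v)"
proof -
  have "real_polynomial_function (\<lambda>d::real^'m. (1 + v i * d $ i) / 2)" for i :: 'm
    unfolding divide_inverse
    by (intro real_polynomial_function.intros bounded_linear_vec_nth)
  then show ?thesis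
    unfolding vertex_weight_def by (intro real_polynomial_function_prod) auto
qed

text \<open>Each coordinate contributes the factor
  \<open>(1 - d $ i) / 2 + (1 + d $ i) / 2 = 1\<close>.\<close>

lemma sum_vertex_weight: "(\<Sum>v\<in>cube_vertices. vertex_weight v d) = 1"
proof -
  have "(\<Sum>v\<in>cube_vertices. vertex_weight v d) = (\<Prod>i\<in>UNIV. \<Sum>s\<in>{-1, 1}. (1 + s * d $ i) / 2)"
    unfolding vertex_weight_def by (rule prod_sum_PiE[symmetric]) auto
  also have "\<dots> = 1"
    by (intro prod.neutral) (simp add: field_simps)
  finally show ?thesis .
qed

text \<open>The factor \<open>v k\<close> is absorbed into coordinate \<open>k\<close>, whose two
  terms then add up to \<open>(1 + d $ k) / 2 - (1 - d $ k) / 2 = d $ k\<close>; the other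
  coordinates still give 1.\<close>

lemma sum_vertex_weight_coord: "(\<Sum>v\<in>cube_vertices. vertex_weight v d * v k) = d $ k"
proof -
  let ?f = "\<lambda>i s. (1 + s * d $ i) / 2 * (if i = k then s else 1)"
  have "(\<Sum>v\<in>cube_vertices. vertex_weight v d * v k) = (\<Sum>v\<in>cube_vertices. \<Prod>i\<in>UNIV. ?f i (v i))"
    by (simp only: vertex_weight_def prod.distrib prod.delta[OF finite] UNIV_I if_True)
  also have "\<dots> = (\<Prod>i\<in>UNIV. \<Sum>s\<in>{-1, 1}. ?f i s)"
    by (rule prod_sum_PiE[symmetric]) auto
  also have "\<dots> = (\<Prod>i\<in>UNIV. if i = k then d $ i else 1)"
    by (intro prod.cong) (auto simp: field_simps)
  finally show ?thesis by simp
qed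

text \<open>The weights reproduce the constant 1 and every coordinate function, hence every affine
  map.\<close>

lemma affine_eq_sum_vertices:
  fixes H0 :: "'a::real_vector" and H :: "'m::finite \<Rightarrow> 'a"
  shows "H0 + (\<Sum>i\<in>UNIV. (d $ i) *\<^sub>R H i)
    = (\<Sum>v\<in>cube_vertices. vertex_weight v d *\<^sub>R (H0 + (\<Sum>i\<in>UNIV. v i *\<^sub>R H i)))"
proof -
  have "(\<Sum>v\<in>cube_vertices. vertex_weight v d *\<^sub>R (H0 + (\<Sum>i\<in>UNIV. v i *\<^sub>R H i)))
      = (\<Sum>v\<in>cube_vertices. vertex_weight v d) *\<^sub>R H0
        + (\<Sum>v\<in>cube_vertices. \<Sum>i\<in>UNIV. (vertex_weight v d * v i) *\<^sub>R H i)"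
    by (simp add: scaleR_add_right sum.distrib scaleR_sum_left scaleR_sum_right)
  also have "(\<Sum>v\<in>cube_vertices. \<Sum>i\<in>UNIV. (vertex_weight v d * v i) *\<^sub>R H i)
      = (\<Sum>i\<in>UNIV. (\<Sum>v\<in>cube_vertices. vertex_weight v d * v i) *\<^sub>R H i)"
    by (subst sum.swap) (simp add: scaleR_sum_left)
  finally show ?thesis
    by (simp add: sum_vertex_weight sum_vertex_weight_coord)
qed

section \<open>The two pieces of the certificate\<close>

lemma vertex_weight_square_sum_sos:
  fixes A :: "('m::finite \<Rightarrow> real) \<Rightarrow> real^'n^'n"
  assumes "finite V" and "\<And>v. v \<in> V \<Longrightarrow> psd_mat (A v)"
  shows "(\<lambda>d. \<Sum>v\<in>V. (vertex_weight v d)\<^sup>2 *\<^sub>R A v) \<in> sos_matrices"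
proof -
  have "\<forall>v\<in>V. \<exists>u :: 'n \<Rightarrow> 'n \<Rightarrow> real. \<forall>i j. A v $ i $ j = (\<Sum>k\<in>UNIV. u k i * u k j)"
    using assms(2) psd_mat_gram by metis
  then obtain u :: "('m \<Rightarrow> real) \<Rightarrow> 'n \<Rightarrow> 'n \<Rightarrow> real"
    where u: "\<And>v i j. v \<in> V \<Longrightarrow> A v $ i $ j = (\<Sum>k\<in>UNIV. u v k i * u v k j)"
    by metis
  show ?thesis
  \<comment> \<open>Column \<open>(v, k)\<close> of \<open>T\<close> is the \<open>k\<close>-th Gram
    vector of \<open>A v\<close> scaled by the weight of \<open>v\<close>; the square of the weight
    comes from multiplying two such entries.\<close>
  proof (rule sos_matricesI[where K = "V \<times> UNIV"
        and T = "\<lambda>i (v, k) d. vertex_weight v d * u v k i"])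
    fix i and vk :: "('m \<Rightarrow> real) \<times> 'n"
    show "real_polynomial_function (case vk of (v, k) \<Rightarrow> \<lambda>d. vertex_weight v d * u v k i)"
      by (cases vk) (auto intro!: real_polynomial_function.intros(2,4) real_polynomial_function_vertex_weight)
  next
    fix d :: "real^'m" and i j
    have "(\<Sum>v\<in>V. (vertex_weight v d)\<^sup>2 *\<^sub>R A v) $ i $ j
        = (\<Sum>v\<in>V. \<Sum>k\<in>UNIV. (vertex_weight v d * u v k i) * (vertex_weight v d * u v k j))"
      by (auto simp: u sum_distrib_left power2_eq_square algebra_simps intro!: sum.cong)
    then show "(\<Sum>v\<in>V. (vertex_weight v d)\<^sup>2 *\<^sub>R A v) $ i $ j
        = (\<Sum>vk\<in>V \<times> UNIV. (case vk of (v, k) \<Rightarrow> \<lambda>d. vertex_weight v d * u v k i) d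
            * (case vk of (v, k) \<Rightarrow> \<lambda>d. vertex_weight v d * u v k j) d)"
      by (simp add: sum.cartesian_product case_prod_unfold)
  qed (use assms(1) in simp)
qed

text \<open>All three powers are padded to three coefficients, the form that
  \<open>Q1_prod_scaleR\<close> takes for its factors.\<close>

lemma affine_power_le_2_expansion:
  fixes b :: real
  assumes "n \<le> (2::nat)"
  shows "\<exists>c. \<forall>t. ((1 + b * t) / 2) ^ n = (\<Sum>k\<le>2. c k * t ^ k)"
proof -
  consider "n = 0" | "n = 1" | "n = 2"
    using assms by linarith
  then show ?thesis
  proof cases
    case 1
    then show ?thesis
      by (intro exI[of _ "\<lambda>k. if k = 0 then 1 else 0"]) (simp add: numeral_2_eq_2)
  next
    case 2
    then show ?thesis
      by (intro exI[of _ "\<lambda>k. if k = 0 then 1/2 else if k = 1 then b/2 else 0"])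
        (simp add: numeral_2_eq_2 field_simps)
  next
    case 3
    then show ?thesis
      by (intro exI[of _ "\<lambda>k. if k = 0 then 1/4 else if k = 1 then b/2 else b\<^sup>2/4"])
        (simp add: numeral_2_eq_2 field_simps)
  qed
qed

text \<open>The telescoping identity is applied at each vertex. The factors
  \<open>1 - (d $ i)\<^sup>2\<close> are the same for all vertices, so the sums can be exchanged and
  the multipliers of each factor collected into one \<open>S i\<close>.\<close>

lemma vertex_weight_minus_square:
  fixes A :: "('m::finite \<Rightarrow> real) \<Rightarrow> real^'n^'n"
  assumes "V \<subseteq> cube_vertices" and sym: "\<And>v. v \<in> V \<Longrightarrow> sym_mat (A v)"
  obtains S :: "'m \<Rightarrow> real^'m \<Rightarrow> real^'n^'n" where "\<And>i. S i \<in> Q1"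
    and "\<And>d. (\<Sum>v\<in>V. vertex_weight v d *\<^sub>R A v) - (\<Sum>v\<in>V. (vertex_weight v d)\<^sup>2 *\<^sub>R A v)
      = (\<Sum>i\<in>UNIV. (1 - (d $ i)\<^sup>2) *\<^sub>R S i d)"
proof -
  obtain \<beta> :: "'m \<Rightarrow> 'm \<Rightarrow> nat" where \<beta>: "\<And>i j. \<beta> i j \<le> 2"
    and eq: "\<And>x :: 'm \<Rightarrow> real.
      prod x UNIV - (prod x UNIV)\<^sup>2 = (\<Sum>i\<in>UNIV. (x i - (x i)\<^sup>2) * (\<Prod>j\<in>UNIV. x j ^ \<beta> i j))"
    using prod_minus_prod_square[OF finite[of UNIV]] by blast
  define P where "P v i d = (\<Prod>j\<in>UNIV. ((1 + v j * d $ j) / 2) ^ \<beta> i j)"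
    for v i and d :: "real^'m"
  \<comment> \<open>The 1/4 from \<open>f - f^2\<close> is attached to the matrix, so that
    \<open>P v i\<close> remains a product of univariate factors.\<close>
  define S where "S i d = (\<Sum>v\<in>V. P v i d *\<^sub>R ((1/4) *\<^sub>R A v))" for i d
  have "(\<lambda>d. P v i d *\<^sub>R ((1/4) *\<^sub>R A v)) \<in> Q1" if "v \<in> V" for v i
  proof -
    have "\<forall>j. \<exists>c. \<forall>t. ((1 + v j * t) / 2) ^ \<beta> i j = (\<Sum>k\<le>2. c k * t ^ k)"
      using affine_power_le_2_expansion[OF \<beta>] by blast
    then obtain c where c: "\<And>j t. ((1 + v j * t) / 2) ^ \<beta> i j = (\<Sum>k\<le>2. c j k * t ^ k)"
      by metis
    show ?thesis
      unfolding P_def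
      by (rule Q1_prod_scaleR[where c = c]) (use sym[OF that] c in \<open>simp_all add: sym_mat_iff\<close>)
  qed
  then have "S i \<in> Q1" for i
    unfolding S_def by (rule Q1_sum)
  moreover have "(\<Sum>v\<in>V. vertex_weight v d *\<^sub>R A v) - (\<Sum>v\<in>V. (vertex_weight v d)\<^sup>2 *\<^sub>R A v)
      = (\<Sum>i\<in>UNIV. (1 - (d $ i)\<^sup>2) *\<^sub>R S i d)" for d
  proof -
    have w: "vertex_weight v d - (vertex_weight v d)\<^sup>2
        = (\<Sum>i\<in>UNIV. (1 - (d $ i)\<^sup>2) * (P v i d / 4))" if "v \<in> V" for v
    proof -
      \<comment> \<open>The sign \<open>v i\<close> enters the difference only through its square,
        which is 1; this removes the dependence on the vertex.\<close>
      have "(1 + v i * d $ i) / 2 - ((1 + v i * d $ i) / 2)\<^sup>2 = (1 - (d $ i)\<^sup>2) / 4" for i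
        using cube_vertices_cases[OF subsetD[OF assms(1) that], of i]
        by (auto simp: power2_eq_square field_simps)
      then show ?thesis
        by (simp only: vertex_weight_def eq P_def times_divide_eq_left times_divide_eq_right)
    qed
    have "(\<Sum>v\<in>V. vertex_weight v d *\<^sub>R A v) - (\<Sum>v\<in>V. (vertex_weight v d)\<^sup>2 *\<^sub>R A v)
        = (\<Sum>v\<in>V. (vertex_weight v d - (vertex_weight v d)\<^sup>2) *\<^sub>R A v)"
      by (simp add: scaleR_diff_left sum_subtractf)
    also have "\<dots> = (\<Sum>v\<in>V. \<Sum>i\<in>UNIV. ((1 - (d $ i)\<^sup>2) * (P v i d / 4)) *\<^sub>R A v)"
      by (intro sum.cong) (simp_all only: w scaleR_sum_left)
    also have "\<dots> = (\<Sum>i\<in>UNIV. \<Sum>v\<in>V. ((1 - (d $ i)\<^sup>2) * (P v i d / 4)) *\<^sub>R A v)"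
      by (rule sum.swap)
    finally show ?thesis
      by (simp add: S_def scaleR_sum_right)
  qed
  ultimately show ?thesis
    using that by blast
qed

section \<open>Positivity on the cube and existence of certificates\<close>

theorem theorem9:
  fixes H0 :: "real^'n^'n"
    and H :: "'m::finite \<Rightarrow> real^'n^'n"
    and G :: "real^'m \<Rightarrow> real^'n^'n"
  assumes "sym_mat H0"
    and "\<And>i. sym_mat (H i)"
    and "\<And>d. G d = H0 + (\<Sum>i\<in>UNIV. (d $ i) *\<^sub>R H i)"
  shows "(\<forall>d\<in>unit_cube. psd_mat (G d)) \<longleftrightarrow>
    (\<exists>S0\<in>sos_matrices. \<exists>S :: 'm \<Rightarrow> real^'m \<Rightarrow> real^'n^'n.
       (\<forall>i. S i \<in> Q1) \<and>
       (\<forall>d. G d = S0 d + (\<Sum>i\<in>UNIV. (1 - (d $ i)\<^sup>2) *\<^sub>R S i d)))"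
proof -
  define vert where "vert v = (\<chi> i. v i)" for v :: "'m \<Rightarrow> real"
  \<comment> \<open>Both directions rest on this identity: one replaces the weights by their
    squares, the other uses that they are nonnegative on the cube.\<close>
  have interp: "G d = (\<Sum>v\<in>cube_vertices. vertex_weight v d *\<^sub>R G (vert v))" for d
    by (simp add: assms(3) vert_def affine_eq_sum_vertices[of H0 d H])
  show ?thesis
  proof
    assume pos: "\<forall>d\<in>unit_cube. psd_mat (G d)"
    have psd: "psd_mat (G (vert v))" if "v \<in> cube_vertices" for v
    proof -
      have "\<bar>v i\<bar> \<le> 1" for i
        using cube_vertices_cases[OF that, of i] by auto
      then show ?thesis
        using pos by (simp add: unit_cube_def vert_def)
    qed
    define S0 where "S0 = (\<lambda>d. \<Sum>v\<in>cube_vertices. (vertex_weight v d)\<^sup>2 *\<^sub>R G (vert v))"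
    have "S0 \<in> sos_matrices"
      unfolding S0_def using finite_cube_vertices psd by (rule vertex_weight_square_sum_sos)
    moreover obtain S :: "'m \<Rightarrow> real^'m \<Rightarrow> real^'n^'n" where "\<And>i. S i \<in> Q1"
      and S: "\<And>d. (\<Sum>v\<in>cube_vertices. vertex_weight v d *\<^sub>R G (vert v)) - S0 d
        = (\<Sum>i\<in>UNIV. (1 - (d $ i)\<^sup>2) *\<^sub>R S i d)"
      using vertex_weight_minus_square[OF order_refl, of "\<lambda>v. G (vert v)"] psd
      unfolding S0_def psd_mat_def by blast
    moreover have "G d = S0 d + (\<Sum>i\<in>UNIV. (1 - (d $ i)\<^sup>2) *\<^sub>R S i d)" for d
      \<comment> \<open>By \<open>interp\<close>, the minuend in \<open>S\<close> is
        \<open>G d\<close> itself.\<close>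
      using S[of d] interp[of d] by (simp add: algebra_simps)
    ultimately show "\<exists>S0\<in>sos_matrices. \<exists>S :: 'm \<Rightarrow> real^'m \<Rightarrow> real^'n^'n.
       (\<forall>i. S i \<in> Q1) \<and>
       (\<forall>d. G d = S0 d + (\<Sum>i\<in>UNIV. (1 - (d $ i)\<^sup>2) *\<^sub>R S i d))"
      by blast
  next
    assume "\<exists>S0\<in>sos_matrices. \<exists>S :: 'm \<Rightarrow> real^'m \<Rightarrow> real^'n^'n.
       (\<forall>i. S i \<in> Q1) \<and>
       (\<forall>d. G d = S0 d + (\<Sum>i\<in>UNIV. (1 - (d $ i)\<^sup>2) *\<^sub>R S i d))"
    then obtain S0 and S :: "'m \<Rightarrow> real^'m \<Rightarrow> real^'n^'n" where S0: "S0 \<in> sos_matrices"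
      and G: "\<And>d. G d = S0 d + (\<Sum>i\<in>UNIV. (1 - (d $ i)\<^sup>2) *\<^sub>R S i d)"
      by blast
    have "psd_mat (G (vert v))" if "v \<in> cube_vertices" for v
    proof -
      have "(v i)\<^sup>2 = 1" for i
        using cube_vertices_cases[OF that, of i] by auto
      then have "G (vert v) = S0 (vert v)"
        unfolding G by (simp add: vert_def)
      then show ?thesis
        using sos_matrices_psd[OF S0] by simp
    qed
    \<comment> \<open>Membership of \<open>d\<close> in the cube makes all weights nonnegative, so
      positivity passes from the vertices to \<open>d\<close>.\<close>
    then have "psd_mat (\<Sum>v\<in>cube_vertices. vertex_weight v d *\<^sub>R G (vert v))" if "d \<in> unit_cube" for d
      using that by (intro psd_mat_sum_scaleR vertex_weight_nonneg)
    then show "\<forall>d\<in>unit_cube. psd_mat (G d)"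
      by (simp add: interp[symmetric])
  qed
qed

end
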